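(* Let $T$ be a lattice. Then the following properties are equivalent: (i) $\mathcal{C}_{L}(T)$ is a complete lattice; (ii) every lattice quotient of every retract of $T$ is complete; (iii) $T$ is a complete lattice and $\mathcal{P}(\omega)$ is not order embeddable in $T$.
   Context: For a poset $P$ and $A\subseteq P$, let $\downarrow A=\{x\in P: x\le y \text{ for some } y\in A\}$ and $\uparrow A=\{x\in P: x\ge y\text{ for some } y\in A\}$. For nonempty subsets $X,Y$ of $P$ the bi-dominating preorder is: $X\le Y$ iff $X\subseteq \downarrow Y$ and $Y\subseteq \uparrow X$ (every element of $X$ is below some element of $Y$ and every element of $Y$ is above some element of $X$); restricted to nonempty convex subsets it is a partial order. For a lattice $T$, $\mathcal{C}_{L}(T)$ denotes the set of nonempty convex sublattices of $T$ ordered by the bi-dominating order. A poset $Q$ is a retract of a poset $P$ if there are order preserving maps $s:Q\to P$, $r:P\to Q$ with $r\circ s=\mathrm{id}_Q$. A lattice quotient of a lattice $L$ is the image of $L$ under a surjective lattice homomorphism. $\mathcal{P}(\omega)$ is the set of all subsets of the nonnegative integers ordered by inclusion; an order embedding is a map $f$ with $x\le y \iff f(x)\le f(y)$. *)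

theory Defs
  imports "HOL-Algebra.Complete_Lattice"
begin

definition down_set :: "'a gorder \<Rightarrow> 'a set \<Rightarrow> 'a set" where
  "down_set P A = {x \<in> carrier P. \<exists>y\<in>A. x \<sqsubseteq>\<^bsub>P\<^esub> y}"

definition up_set :: "'a gorder \<Rightarrow> 'a set \<Rightarrow> 'a set" where
  "up_set P A = {x \<in> carrier P. \<exists>y\<in>A. y \<sqsubseteq>\<^bsub>P\<^esub> x}"

definition bi_dominated :: "'a gorder \<Rightarrow> 'a set \<Rightarrow> 'a set \<Rightarrow> bool" where
  "bi_dominated P X Y \<longleftrightarrow> X \<subseteq> down_set P Y \<and> Y \<subseteq> up_set P X"

definition order_convex :: "'a gorder \<Rightarrow> 'a set \<Rightarrow> bool" where
  "order_convex P X \<longleftrightarrow> X \<subseteq> carrier P \<and> (\<forall>x\<in>X. \<forall>z\<in>X. \<lbrace>x..z\<rbrace>\<^bsub>P\<^esub> \<subseteq> X)"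

definition sublattice :: "'a gorder \<Rightarrow> 'a set \<Rightarrow> bool" where
  "sublattice T X \<longleftrightarrow>
     X \<subseteq> carrier T \<and> (\<forall>x\<in>X. \<forall>y\<in>X. x \<squnion>\<^bsub>T\<^esub> y \<in> X \<and> x \<sqinter>\<^bsub>T\<^esub> y \<in> X)"

definition convex_sublattices :: "'a gorder \<Rightarrow> 'a set gorder" where
  "convex_sublattices T =
     \<lparr>carrier = {X. X \<noteq> {} \<and> order_convex T X \<and> sublattice T X},
      eq = (=), le = bi_dominated T\<rparr>"

definition order_retract :: "'b gorder \<Rightarrow> 'a gorder \<Rightarrow> bool" where
  "order_retract Q P \<longleftrightarrow> partial_order Q \<and> partial_order P \<and>
     (\<exists>s\<in>carrier Q \<rightarrow> carrier P. \<exists>r\<in>carrier P \<rightarrow> carrier Q.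
        isotone Q P s \<and> isotone P Q r \<and> (\<forall>x\<in>carrier Q. r (s x) = x))"

text \<open>\<^const>\<open>join_pres\<close> and \<^const>\<open>meet_pres\<close> include that both structures are lattices.\<close>

definition lattice_quotient :: "'c gorder \<Rightarrow> 'b gorder \<Rightarrow> bool" where
  "lattice_quotient M L \<longleftrightarrow>
     (\<exists>h. h ` carrier L = carrier M \<and> join_pres L M h \<and> meet_pres L M h)"

text \<open>
  HOL formulas cannot quantify over types, so the types carrying the retracts and their
  quotients are parameters. For \<open>T :: 'a gorder\<close>, both may be taken to be \<open>'a\<close> up to isomorphism:
  the section embeds a retract into \<open>T\<close>, and a quotient is in bijection with a set of
  representatives.
\<close>

definition retract_quotients_complete :: "'b itself \<Rightarrow> 'c itself \<Rightarrow> 'a gorder \<Rightarrow> bool" where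
  "retract_quotients_complete _ _ T \<longleftrightarrow>
     (\<forall>(Q :: 'b gorder) (M :: 'c gorder).
        order_retract Q T \<longrightarrow> lattice_quotient M Q \<longrightarrow> complete_lattice M)"

abbreviation powerset_omega :: "nat set gorder" where
  "powerset_omega \<equiv> \<lparr>carrier = Pow UNIV, eq = (=), le = (\<subseteq>)\<rparr>"

definition order_embeddable :: "'b gorder \<Rightarrow> 'a gorder \<Rightarrow> bool" where
  "order_embeddable P Q \<longleftrightarrow> (\<exists>f\<in>carrier P \<rightarrow> carrier Q. order_emb P Q f)"

end

theory Submission
  imports Defs "HOL-Library.Nat_Bijection" "HOL-Library.Infinite_Set"
begin

text \<open>
  Both implications out of (iii) rest on one stabilization argument. Let \<open>I\<close> be a join-closed and
  \<open>F\<close> a meet-closed subset of \<open>T\<close> such that \<open>\<Squnion>{i \<sqinter> y | i \<in> I} \<in> F\<close> for all \<open>y \<in> F\<close>. Unless some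
  \<open>y \<in> F\<close> satisfies \<open>\<forall>t \<in> F. \<exists>i \<in> I. y \<sqsubseteq> i \<squnion> t\<close>, one can choose \<open>i\<^sub>0 \<sqsubseteq> i\<^sub>1 \<sqsubseteq> \<dots>\<close> in \<open>I\<close> and
  \<open>\<dots> \<sqsubseteq> y\<^sub>1 \<sqsubseteq> y\<^sub>0\<close> in \<open>F\<close> such that \<open>z\<^sub>n = i\<^bsub>n+1\<^esub> \<sqinter> y\<^sub>n\<close> is never below \<open>w\<^sub>n = i\<^sub>n \<squnion> y\<^bsub>n+1\<^esub>\<close>. Then
  \<open>z\<^sub>m \<sqsubseteq> w\<^sub>n\<close> iff \<open>m \<noteq> n\<close>, and \<open>A \<mapsto> \<Squnion>{z\<^sub>n | n \<in> A}\<close> embeds the powerset of \<open>\<omega>\<close>.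

  For a quotient map \<open>h\<close> and a set \<open>X\<close> in the quotient, take for \<open>F\<close> the preimage of the upper bounds
  of \<open>X\<close> and for \<open>I\<close> the preimage of the lower bounds of those; then \<open>h y\<close> is the supremum of \<open>X\<close>.
  For a family of convex sublattices, take for \<open>F\<close> the intersection of their up-sets and for \<open>I\<close> the
  intersection of the down-sets of all upper bounds; then \<open>y \<in> I \<inter> F\<close>, and \<open>I \<inter> F\<close> is the supremum.

  Conversely, an embedding \<open>f\<close> of the powerset of \<open>\<omega>\<close> makes the powerset a retract of \<open>T\<close>, and it
  embeds the powerset modulo finite sets into the convex sublattices via
  \<open>A \<mapsto> \<Union>{[f D, f E] | D, E differ finitely from A}\<close>. In the powerset modulo finite sets, the
  columns of \<open>\<omega> \<times> \<omega>\<close> have no least upper bound.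
\<close>

section \<open>Suprema and infima in partial orders\<close>

text \<open>Infima come for free: that of \<open>A\<close> is the supremum of the lower bounds of
  \<open>A\<close>.\<close>

lemma (in partial_order) complete_lattice_if_lubs:
  assumes lubs: "\<And>A. A \<subseteq> carrier L \<Longrightarrow> \<exists>s. is_lub L s A"
  shows "complete_lattice L"
proof (rule complete_latticeI)
  fix A assume A: "A \<subseteq> carrier L"
  obtain s where s: "is_lub L s (Lower L A)"
    using lubs[of "Lower L A"] by auto
  have "is_glb L s A"
  proof (rule greatest_LowerI)
    fix x assume x: "x \<in> A"
    show "s \<sqsubseteq> x"
      by (rule least_le[OF s]) (use x A in \<open>auto intro!: Upper_memI\<close>)
  next
    fix y assume "y \<in> Lower L A"
    then show "y \<sqsubseteq> s"
      using least_Upper_above[OF s] by auto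
  qed (use A s in auto)
  then show "\<exists>i. is_glb L i A" ..
qed (rule lubs)

text \<open>The binary join is an arbitrary choice of a least upper bound; uniqueness makes it
  computable in the concrete lattices built below.\<close>

lemma (in partial_order) join_eq:
  assumes "is_lub L s {x, y}"
  shows "x \<squnion> y = s"
  unfolding join_def sup_def using assms by (blast intro: some_equality least_unique)

lemma (in partial_order) meet_eq:
  assumes "is_glb L s {x, y}"
  shows "x \<sqinter> y = s"
  unfolding meet_def inf_def using assms by (blast intro: some_equality greatest_unique)

section \<open>Embeddings of the powerset and the stabilization argument\<close>

text \<open>Each \<open>w n\<close> is a separator: it bounds every supremum of elements
  \<open>z m\<close> with \<open>m \<noteq> n\<close>, but no supremum in which \<open>z n\<close>
  takes part.\<close>

lemma order_embeddable_powersetI: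
  fixes T :: "'a gorder" (structure)
  assumes "complete_lattice T"
    and z: "\<And>n. z n \<in> carrier T" and w: "\<And>n. w n \<in> carrier T"
    and zw: "\<And>m n :: nat. z m \<sqsubseteq> w n \<longleftrightarrow> m \<noteq> n"
  shows "order_embeddable powerset_omega T"
proof -
  interpret T: complete_lattice T by fact
  define f where "f A = \<Squnion>(z ` A)" for A
  have f: "f A \<in> carrier T" for A
    unfolding f_def using z by (intro T.sup_closed) auto
  have iff: "f A \<sqsubseteq> f B \<longleftrightarrow> A \<subseteq> B" for A B
  proof
    assume le: "f A \<sqsubseteq> f B"
    show "A \<subseteq> B"
    proof (rule subsetI, rule ccontr)
      fix n assume n: "n \<in> A" "n \<notin> B"
      have "z n \<sqsubseteq> f A"
        unfolding f_def using n z by (intro T.sup_upper) auto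
      moreover have "f B \<sqsubseteq> w n"
        unfolding f_def using n z w zw by (intro T.sup_least) auto
      ultimately have "z n \<sqsubseteq> w n"
        using le z w f by (meson T.le_trans)
      then show False using zw by auto
    qed
  next
    assume "A \<subseteq> B"
    then show "f A \<sqsubseteq> f B"
      unfolding f_def using z by (intro T.sup_least T.sup_upper T.sup_closed) auto
  qed
  have "weak_partial_order powerset_omega"
    by unfold_locales auto
  then have "order_emb powerset_omega T f"
    unfolding order_emb_def using T.weak_partial_order_axioms iff by auto
  then show ?thesis
    unfolding order_embeddable_def using f by auto
qed

lemma order_embeddable_powersetE:
  fixes T :: "'a gorder" (structure)
  assumes "order_embeddable powerset_omega T"
  obtains f :: "nat set \<Rightarrow> 'a" where "\<And>A. f A \<in> carrier T" "\<And>A B. f A \<sqsubseteq> f B \<longleftrightarrow> A \<subseteq> B"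
proof -
  obtain f :: "nat set \<Rightarrow> 'a" where "f \<in> UNIV \<rightarrow> carrier T" "\<And>A B. f A \<sqsubseteq> f B \<longleftrightarrow> A \<subseteq> B"
    using assms unfolding order_embeddable_def order_emb_def by auto
  then show thesis using that[of f] by auto
qed

lemma stabilization:
  fixes T :: "'a gorder" (structure)
  assumes "complete_lattice T" and no_emb: "\<not> order_embeddable powerset_omega T"
    and I: "I \<subseteq> carrier T" "I \<noteq> {}" "\<And>x y. x \<in> I \<Longrightarrow> y \<in> I \<Longrightarrow> x \<squnion> y \<in> I"
    and F: "F \<subseteq> carrier T" "F \<noteq> {}" "\<And>x y. x \<in> F \<Longrightarrow> y \<in> F \<Longrightarrow> x \<sqinter> y \<in> F"
    and IF: "\<And>y. y \<in> F \<Longrightarrow> \<Squnion>((\<lambda>i. i \<sqinter> y) ` I) \<in> F"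
  obtains y where "y \<in> F" "\<And>t. t \<in> F \<Longrightarrow> \<exists>i\<in>I. y \<sqsubseteq> i \<squnion> t"
proof (rule ccontr)
  assume "\<not> thesis"
  with that have no: "\<exists>t\<in>F. \<forall>i\<in>I. \<not> s \<sqsubseteq> i \<squnion> t" if "s \<in> F" for s
    using \<open>s \<in> F\<close> by blast
  interpret T: complete_lattice T by fact
  have IT: "i \<in> carrier T" if "i \<in> I" for i using I(1) that by auto
  have FT: "y \<in> carrier T" if "y \<in> F" for y using F(1) that by auto
  \<comment> \<open>The state \<open>p\<close> pairs an element of \<open>I\<close> with one of
    \<open>F\<close>. The last three conjuncts are ascent in \<open>I\<close>, descent in
    \<open>F\<close>, and the failure that becomes
    \<open>\<not> z n \<sqsubseteq> w n\<close>.\<close>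
  have step: "\<exists>q. (fst q \<in> I \<and> snd q \<in> F) \<and>
      fst p \<sqsubseteq> fst q \<and> snd q \<sqsubseteq> snd p \<and> \<not> fst q \<sqinter> snd p \<sqsubseteq> fst p \<squnion> snd q"
    if p_mem: "fst p \<in> I \<and> snd p \<in> F" for p
  proof -
    obtain i y where p: "p = (i, y)" "i \<in> I" "y \<in> F" using p_mem by (metis prod.collapse)
    \<comment> \<open>The failure is taken at the supremum of all \<open>i \<sqinter> y\<close>
      instead of at \<open>y\<close>. A supremum that is not below a bound has a member that is not
      below it, and this yields \<open>j\<close>.\<close>
    obtain t where t: "t \<in> F" "\<not> \<Squnion>((\<lambda>i. i \<sqinter> y) ` I) \<sqsubseteq> i \<squnion> t"
      using no[OF IF[OF p(3)]] p(2) by blast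
    note c [simp] = IT[OF p(2)] FT[OF p(3)] FT[OF t(1)]
    \<comment> \<open>To keep the sequences monotone, \<open>t\<close> is lowered to
      \<open>t \<sqinter> y\<close>, and later \<open>j\<close> is raised to
      \<open>j \<squnion> i\<close>. Both changes preserve the failure: the first shrinks the
      right-hand side, the second enlarges the left-hand side.\<close>
    have ty: "t \<sqinter> y \<in> F" using F(3) t p by auto
    have "\<exists>j\<in>I. \<not> j \<sqinter> y \<sqsubseteq> i \<squnion> t \<sqinter> y"
    proof (rule ccontr)
      assume "\<not> ?thesis"
      then have "\<Squnion>((\<lambda>i. i \<sqinter> y) ` I) \<sqsubseteq> i \<squnion> t \<sqinter> y"
        by (intro T.sup_least) (auto simp: IT)
      moreover have "i \<squnion> t \<sqinter> y \<sqsubseteq> i \<squnion> t"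
        by (intro T.join_le T.join_left T.le_trans[OF T.meet_left T.join_right]) auto
      ultimately have "\<Squnion>((\<lambda>i. i \<sqinter> y) ` I) \<sqsubseteq> i \<squnion> t"
        using FT[OF IF[OF p(3)]] by (rule T.le_trans) auto
      then show False using t by auto
    qed
    then obtain j where j: "j \<in> I" "\<not> j \<sqinter> y \<sqsubseteq> i \<squnion> t \<sqinter> y" by auto
    note [simp] = IT[OF j(1)]
    have "j \<sqinter> y \<sqsubseteq> (j \<squnion> i) \<sqinter> y"
      by (intro T.meet_le T.meet_right T.le_trans[OF T.meet_left T.join_left]) auto
    then have "\<not> (j \<squnion> i) \<sqinter> y \<sqsubseteq> i \<squnion> t \<sqinter> y"
      using j(2) T.le_trans[of "j \<sqinter> y" "(j \<squnion> i) \<sqinter> y" "i \<squnion> t \<sqinter> y"] by auto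
    moreover have "i \<sqsubseteq> j \<squnion> i" "t \<sqinter> y \<sqsubseteq> y"
      by (auto intro: T.join_right T.meet_right)
    ultimately show ?thesis
      using ty I(3)[OF j(1) p(2)] p(1) by (intro exI[of _ "(j \<squnion> i, t \<sqinter> y)"]) auto
  qed
  have "\<exists>p. fst p \<in> I \<and> snd p \<in> F" using I(2) F(2) by auto
  from dependent_nat_choice[of "\<lambda>_ p. fst p \<in> I \<and> snd p \<in> F"
      "\<lambda>_ p q. fst p \<sqsubseteq> fst q \<and> snd q \<sqsubseteq> snd p \<and> \<not> fst q \<sqinter> snd p \<sqsubseteq> fst p \<squnion> snd q", OF this step]
  obtain g where g: "\<And>n. fst (g n) \<in> I \<and> snd (g n) \<in> F"
    "\<And>n. fst (g n) \<sqsubseteq> fst (g (Suc n)) \<and> snd (g (Suc n)) \<sqsubseteq> snd (g n) \<and>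
      \<not> fst (g (Suc n)) \<sqinter> snd (g n) \<sqsubseteq> fst (g n) \<squnion> snd (g (Suc n))"
    by blast
  define i where "i n = fst (g n)" for n
  define y where "y n = snd (g n)" for n
  have [simp]: "i n \<in> carrier T" "y n \<in> carrier T" for n
    using g(1) IT FT by (auto simp: i_def y_def)
  have suc: "i n \<sqsubseteq> i (Suc n)" "y (Suc n) \<sqsubseteq> y n" for n
    using g(2)[of n] by (auto simp: i_def y_def)
  have i_mono: "i m \<sqsubseteq> i n" if "m \<le> n" for m n
    using that
  proof (induction rule: dec_induct)
    case (step n)
    then show ?case using suc T.le_trans[of "i m" "i n" "i (Suc n)"] by auto
  qed auto
  have y_mono: "y n \<sqsubseteq> y m" if "m \<le> n" for m n
    using that
  proof (induction rule: dec_induct)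
    case (step n)
    then show ?case using suc T.le_trans[of "y (Suc n)" "y n" "y m"] by auto
  qed auto
  \<comment> \<open>The shifts by one are what singles out \<open>m = n\<close>:
    \<open>z m \<sqsubseteq> i (Suc m) \<sqsubseteq> i n\<close> if \<open>m < n\<close>, and
    \<open>z m \<sqsubseteq> y m \<sqsubseteq> y (Suc n)\<close> if \<open>n < m\<close>.\<close>
  define z where "z n = i (Suc n) \<sqinter> y n" for n
  define w where "w n = i n \<squnion> y (Suc n)" for n
  have [simp]: "z n \<in> carrier T" "w n \<in> carrier T" for n
    by (auto simp: z_def w_def)
  have "z m \<sqsubseteq> w n \<longleftrightarrow> m \<noteq> n" for m n
  proof
    assume "z m \<sqsubseteq> w n"
    then show "m \<noteq> n"
      using g(2)[of n] by (auto simp: z_def w_def i_def y_def)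
  next
    assume "m \<noteq> n"
    then consider "m < n" | "n < m" by linarith
    then show "z m \<sqsubseteq> w n"
    proof cases
      case 1
      have "z m \<sqsubseteq> i (Suc m)" unfolding z_def by (rule T.meet_left) auto
      also have "\<dots> \<sqsubseteq> i n" using 1 by (intro i_mono) auto
      also have "\<dots> \<sqsubseteq> w n" unfolding w_def by (rule T.join_left) auto
      finally show ?thesis by simp
    next
      case 2
      have "z m \<sqsubseteq> y m" unfolding z_def by (rule T.meet_right) auto
      also have "\<dots> \<sqsubseteq> y (Suc n)" using 2 by (intro y_mono) auto
      also have "\<dots> \<sqsubseteq> w n" unfolding w_def by (rule T.join_right) auto
      finally show ?thesis by simp
    qed
  qed
  then have "order_embeddable powerset_omega T"
    using order_embeddable_powersetI[of T z w] T.complete_lattice_axioms by simp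
  then show False using no_emb by simp
qed

section \<open>Retracts and quotients: (iii) implies (ii)\<close>

text \<open>A section reflects the order, since applying \<open>r\<close> undoes \<open>s\<close>;
  so it can be composed with an embedding. Absence of the powerset thus passes from \<open>T\<close>
  to its retracts.\<close>

lemma order_embeddable_retract:
  assumes "order_retract Q P" "order_embeddable R Q"
  shows "order_embeddable R P"
proof -
  obtain s r where sr: "s \<in> carrier Q \<rightarrow> carrier P" "isotone Q P s" "isotone P Q r"
    "\<And>x. x \<in> carrier Q \<Longrightarrow> r (s x) = x"
    using assms(1) unfolding order_retract_def by blast
  obtain f where f: "f \<in> carrier R \<rightarrow> carrier Q" "order_emb R Q f"
    using assms(2) unfolding order_embeddable_def by blast
  have "le P (s u) (s v) \<longleftrightarrow> le Q u v" if "u \<in> carrier Q" "v \<in> carrier Q" for u v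
    using sr that unfolding isotone_def by (metis Pi_mem)
  then have "order_emb R P (s \<circ> f)"
    using f sr(2) unfolding order_emb_def isotone_def by (simp add: Pi_iff)
  then show ?thesis
    unfolding order_embeddable_def using f(1) sr(1) by (intro bexI[of _ "s \<circ> f"]) auto
qed

text \<open>Suprema are formed in \<open>P\<close> after applying \<open>s\<close> and brought back
  by \<open>r\<close>. They are least because \<open>s y\<close> bounds \<open>s\<close> applied to
  \<open>A\<close> whenever \<open>y\<close> bounds \<open>A\<close>, and \<open>r\<close> returns
  \<open>s y\<close> to \<open>y\<close>.\<close>

lemma complete_lattice_retract:
  assumes "order_retract Q P" "complete_lattice P"
  shows "complete_lattice Q"
proof -
  obtain s r where sr: "s \<in> carrier Q \<rightarrow> carrier P" "r \<in> carrier P \<rightarrow> carrier Q"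
    "isotone Q P s" "isotone P Q r" "\<And>x. x \<in> carrier Q \<Longrightarrow> r (s x) = x"
    using assms(1) unfolding order_retract_def by blast
  interpret Q: partial_order Q using assms(1) by (simp add: order_retract_def)
  interpret P: complete_lattice P by fact
  show ?thesis
  proof (rule Q.complete_lattice_if_lubs)
    fix A assume A: "A \<subseteq> carrier Q"
    have sA: "s ` A \<subseteq> carrier P" using A sr(1) by auto
    then have c: "\<Squnion>\<^bsub>P\<^esub>(s ` A) \<in> carrier P" by simp
    have "is_lub Q (r (\<Squnion>\<^bsub>P\<^esub>(s ` A))) A"
    proof (rule least_UpperI)
      fix x assume x: "x \<in> A"
      then have "le P (s x) (\<Squnion>\<^bsub>P\<^esub>(s ` A))" using sA by (intro P.sup_upper) auto
      then have "le Q (r (s x)) (r (\<Squnion>\<^bsub>P\<^esub>(s ` A)))"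
        using use_iso2[OF sr(4)] c sA x by (metis image_subset_iff)
      then show "le Q x (r (\<Squnion>\<^bsub>P\<^esub>(s ` A)))" using sr(5) A x by auto
    next
      fix y assume y: "y \<in> Upper Q A"
      then have yc: "y \<in> carrier Q" by (simp add: Upper_def)
      have "le P (\<Squnion>\<^bsub>P\<^esub>(s ` A)) (s y)"
        using sA sr(1) yc by (intro P.sup_least) (auto intro!: use_iso2[OF sr(3)] dest: Upper_memD[OF y _ A] subsetD[OF A])
      then have "le Q (r (\<Squnion>\<^bsub>P\<^esub>(s ` A))) (r (s y))"
        using use_iso2[OF sr(4)] c sr(1) yc by (metis Pi_mem)
      then show "le Q (r (\<Squnion>\<^bsub>P\<^esub>(s ` A))) y" using sr(5) yc by auto
    qed (use A c sr(2) in auto)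
    then show "\<exists>s. is_lub Q s A" ..
  qed
qed

text \<open>The homomorphism respects only finite joins and meets, so the image of a supremum in
  \<open>L\<close> need not be a supremum in \<open>M\<close>. Stabilization supplies a preimage for
  which it is.\<close>

lemma complete_lattice_quotient:
  fixes L :: "'b gorder" and M :: "'c gorder"
  assumes "complete_lattice L" "\<not> order_embeddable powerset_omega L" "lattice_quotient M L"
  shows "complete_lattice M"
proof -
  obtain h where h: "h ` carrier L = carrier M" "join_pres L M h" "meet_pres L M h"
    using assms(3) unfolding lattice_quotient_def by blast
  interpret L: complete_lattice L by fact
  interpret M: lattice M using h(2) by (simp add: join_pres_def)
  have hc [simp]: "h x \<in> carrier M" if "x \<in> carrier L" for x using h(1) that by auto
  have h_join: "h (x \<squnion>\<^bsub>L\<^esub> y) = h x \<squnion>\<^bsub>M\<^esub> h y"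
    and h_meet: "h (x \<sqinter>\<^bsub>L\<^esub> y) = h x \<sqinter>\<^bsub>M\<^esub> h y"
    if "x \<in> carrier L" "y \<in> carrier L" for x y
    using h that by (auto simp: join_pres_def meet_pres_def)
  have h_mono: "le M (h x) (h y)" if "le L x y" "x \<in> carrier L" "y \<in> carrier L" for x y
    using join_pres_isotone[OF _ h(2)] that by (auto simp: isotone_def)
  show ?thesis
  proof (rule M.complete_lattice_if_lubs)
    fix X assume X: "X \<subseteq> carrier M"
    define F where "F = {y \<in> carrier L. h y \<in> Upper M X}"
    define I where "I = {x \<in> carrier L. h x \<in> Lower M (Upper M X)}"
    have F_iff: "y \<in> F \<longleftrightarrow> y \<in> carrier L \<and> (\<forall>x\<in>X. le M x (h y))" for y
      using X by (auto simp: F_def Upper_def)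
    \<comment> \<open>By surjectivity the upper bounds of \<open>X\<close> are exactly the images of
      \<open>F\<close>, so \<open>I\<close> can be described by comparison with \<open>F\<close>
      alone.\<close>
    have I_iff: "i \<in> I \<longleftrightarrow> i \<in> carrier L \<and> (\<forall>y\<in>F. le M (h i) (h y))" for i
    proof -
      have img: "Upper M X = h ` F"
      proof (intro equalityI subsetI)
        fix u assume u: "u \<in> Upper M X"
        then have "u \<in> h ` carrier L" using h(1) by (simp add: Upper_def)
        then show "u \<in> h ` F" using u by (auto simp: F_def)
      qed (auto simp: F_def)
      have "i \<in> I \<longleftrightarrow> i \<in> carrier L \<and> (\<forall>u\<in>Upper M X. le M (h i) u)"
        by (auto simp: I_def Lower_def dest: subsetD[OF Upper_closed])
      then show ?thesis unfolding img by simp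
    qed
    have top: "\<top>\<^bsub>L\<^esub> \<in> F"
      unfolding F_iff
    proof (intro conjI ballI)
      fix x assume "x \<in> X"
      then obtain a where "a \<in> carrier L" "x = h a" using X h(1) by blast
      then show "le M x (h \<top>\<^bsub>L\<^esub>)" using h_mono by simp
    qed simp
    obtain y where y: "y \<in> F" "\<And>t. t \<in> F \<Longrightarrow> \<exists>i\<in>I. le L y (i \<squnion>\<^bsub>L\<^esub> t)"
    proof (rule stabilization[OF assms(1,2), of I F])
      have "\<bottom>\<^bsub>L\<^esub> \<in> I"
        unfolding I_iff using F_iff by (auto intro!: h_mono)
      then show "I \<noteq> {}" by auto
      show "x \<squnion>\<^bsub>L\<^esub> y \<in> I" if "x \<in> I" "y \<in> I" for x y
        using that F_iff by (auto simp: I_iff h_join intro!: M.join_le)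
      show "x \<sqinter>\<^bsub>L\<^esub> y \<in> F" if "x \<in> F" "y \<in> F" for x y
        using that X by (auto simp: F_iff h_meet intro!: M.meet_le)
      show "\<Squnion>\<^bsub>L\<^esub>((\<lambda>i. i \<sqinter>\<^bsub>L\<^esub> y) ` I) \<in> F" if y: "y \<in> F" for y
        unfolding F_iff
      proof (intro conjI ballI)
        have c: "(\<lambda>i. i \<sqinter>\<^bsub>L\<^esub> y) ` I \<subseteq> carrier L"
          using y by (auto simp: F_iff I_iff)
        then show s: "\<Squnion>\<^bsub>L\<^esub>((\<lambda>i. i \<sqinter>\<^bsub>L\<^esub> y) ` I) \<in> carrier L" by simp
        fix x assume x: "x \<in> X"
        obtain a where a: "a \<in> carrier L" "x = h a" using x X h(1) by auto
        \<comment> \<open>As \<open>x\<close> lies below every upper bound of \<open>X\<close>, its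
          preimage \<open>a\<close> is in \<open>I\<close>. Since \<open>x\<close> is below
          \<open>h y\<close>, meeting \<open>a\<close> with \<open>y\<close> does not change the
          image \<open>x\<close>.\<close>
        have "a \<in> I" unfolding I_iff using a x F_iff by auto
        then have "le L (a \<sqinter>\<^bsub>L\<^esub> y) (\<Squnion>\<^bsub>L\<^esub>((\<lambda>i. i \<sqinter>\<^bsub>L\<^esub> y) ` I))"
          using c by (intro L.sup_upper) auto
        then have "le M (h (a \<sqinter>\<^bsub>L\<^esub> y)) (h (\<Squnion>\<^bsub>L\<^esub>((\<lambda>i. i \<sqinter>\<^bsub>L\<^esub> y) ` I)))"
          using s a y by (intro h_mono) (auto simp: F_iff)
        moreover have "h (a \<sqinter>\<^bsub>L\<^esub> y) = x"
          using a y x M.le_iff_join[of x "h y"] by (auto simp: F_iff h_meet)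
        ultimately show "le M x (h (\<Squnion>\<^bsub>L\<^esub>((\<lambda>i. i \<sqinter>\<^bsub>L\<^esub> y) ` I)))" by simp
      qed
      show "I \<subseteq> carrier L" "F \<subseteq> carrier L" by (auto simp: I_def F_def)
      show "F \<noteq> {}" using top by blast
    next
      fix y assume "y \<in> F" "\<And>t. t \<in> F \<Longrightarrow> \<exists>i\<in>I. le L y (i \<squnion>\<^bsub>L\<^esub> t)"
      then show thesis by (rule that)
    qed
    have "is_lub M (h y) X"
    proof (rule least_UpperI)
      fix u assume u: "u \<in> Upper M X"
      then have "u \<in> h ` carrier L" using h(1) by (simp add: Upper_def)
      then obtain t where t: "t \<in> carrier L" "u = h t" by blast
      have tF: "t \<in> F" using u t by (simp add: F_def)
      \<comment> \<open>Under \<open>h\<close> the inequality becomes \<open>h y\<close> below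
        \<open>h i \<squnion> h t\<close>, and \<open>h i\<close> is absorbed by the upper bound
        \<open>h t\<close>.\<close>
      then obtain i where i: "i \<in> I" "le L y (i \<squnion>\<^bsub>L\<^esub> t)" using y(2) by blast
      have "le M (h y) (h i \<squnion>\<^bsub>M\<^esub> h t)"
        using h_mono[OF i(2)] i(1) y(1) t by (auto simp: h_join F_iff I_iff)
      moreover have "h i \<squnion>\<^bsub>M\<^esub> h t = h t"
        using i(1) tF t M.le_iff_meet[of "h i" "h t"] by (auto simp: I_iff)
      ultimately show "le M (h y) u" using t by simp
    qed (use y(1) X in \<open>auto simp: F_iff\<close>)
    then show "\<exists>s. is_lub M s X" ..
  qed
qed

text \<open>Both halves of (iii) pass to retracts, where the quotient lemma applies. The types
  \<open>'b\<close> and \<open>'c\<close> stay arbitrary, which makes the change of types in the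
  theorem possible.\<close>

lemma retract_quotients_completeI:
  fixes T :: "'a gorder"
  assumes "complete_lattice T" "\<not> order_embeddable powerset_omega T"
  shows "retract_quotients_complete TYPE('b) TYPE('c) T"
  unfolding retract_quotients_complete_def
  using assms complete_lattice_retract order_embeddable_retract complete_lattice_quotient by blast


section \<open>The powerset modulo finite sets: (ii) implies (iii)\<close>

text \<open>Diagonalization: \<open>S\<close> meets every column, since columns are infinite.
  Removing one point of \<open>S\<close> from each column costs every column a single point, but
  costs \<open>S\<close> infinitely many.\<close>

lemma almost_upper_bounds_not_least:
  fixes S :: "nat set"
  assumes S: "\<And>n. finite ({k. fst (prod_decode k) = n} - S)"
  obtains S' where "\<And>n. finite ({k. fst (prod_decode k) = n} - S')" "infinite (S - S')"
proof -
  define B where "B n = {k. fst (prod_decode k) = n}" for n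
  have "infinite (B n)" for n
  proof -
    have "range (\<lambda>m. prod_encode (n, m)) \<subseteq> B n" by (auto simp: B_def)
    moreover have "infinite (range (\<lambda>m. prod_encode (n, m)))"
      by (intro range_inj_infinite injI) simp
    ultimately show ?thesis using infinite_super by blast
  qed
  then have "B n \<inter> S \<noteq> {}" for n
    using S[of n] by (metis B_def Diff_triv)
  then have "\<forall>n. \<exists>k. k \<in> B n \<and> k \<in> S" by blast
  then obtain g where "\<forall>n. g n \<in> B n \<and> g n \<in> S" by metis
  then have g: "g n \<in> B n" "g n \<in> S" for n by auto
  have fst_g: "fst (prod_decode (g n)) = n" for n using g(1) by (simp add: B_def)
  have "finite (B n - (S - range g))" for n
  proof (rule finite_subset)
    show "B n - (S - range g) \<subseteq> insert (g n) (B n - S)"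
      using fst_g by (auto simp: B_def)
    show "finite (insert (g n) (B n - S))" using S by (simp add: B_def)
  qed
  moreover have "infinite (S - (S - range g))"
  proof -
    have "S - (S - range g) = range g" using g(2) by auto
    moreover have "infinite (range g)"
      by (intro range_inj_infinite injI) (metis fst_g)
    ultimately show ?thesis by simp
  qed
  ultimately show thesis using that[of "S - range g"] by (simp add: B_def)
qed

text \<open>The image of the embedding is a retract of \<open>T\<close>, and the powerset modulo
  finite sets is a quotient of it in which the columns have no supremum. Both need carriers in
  \<open>'a\<close>, so a class of sets is represented by \<open>f\<close> of a chosen
  member.\<close>

lemma not_embeddable_if_retract_quotients_complete:
  fixes T :: "'a gorder" (structure)
  assumes rqc: "retract_quotients_complete TYPE('a) TYPE('a) T" and "complete_lattice T"
  shows "\<not> order_embeddable powerset_omega T"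
proof
  assume "order_embeddable powerset_omega T"
  then obtain f :: "nat set \<Rightarrow> 'a" where f: "\<And>A. f A \<in> carrier T" "\<And>A B. f A \<sqsubseteq> f B \<longleftrightarrow> A \<subseteq> B"
    by (rule order_embeddable_powersetE) blast
  interpret T: complete_lattice T by fact
  have inj: "f A = f B \<longleftrightarrow> A = B" for A B
    using f T.le_refl by (metis subset_antisym order_refl)
  define g where "g = inv f"
  have gf [simp]: "g (f A) = A" for A
    unfolding g_def by (intro inv_f_f injI) (simp add: inj)
  define E where "E A B \<longleftrightarrow> finite (A - B) \<and> finite (B - A)" for A B :: "nat set"
  define rep where "rep A = (SOME B. E A B)" for A
  have rep: "finite (A - rep A)" "finite (rep A - A)" for A
  proof -
    have "E A (rep A)" unfolding rep_def by (rule someI[of _ A]) (simp add: E_def)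
    then show "finite (A - rep A)" "finite (rep A - A)" by (auto simp: E_def)
  qed
  have rep_le: "finite (rep A - rep B) \<longleftrightarrow> finite (A - B)" for A B
  proof
    have "A - B \<subseteq> (A - rep A) \<union> (rep A - rep B) \<union> (rep B - B)" by auto
    then show "finite (A - B)" if "finite (rep A - rep B)"
      using that rep by (meson finite_Un finite_subset)
    have "rep A - rep B \<subseteq> (rep A - A) \<union> (A - B) \<union> (B - rep B)" by auto
    then show "finite (rep A - rep B)" if "finite (A - B)"
      using that rep by (meson finite_Un finite_subset)
  qed
  have rep_eq: "rep A = rep B \<longleftrightarrow> finite (A - B) \<and> finite (B - A)" for A B
  proof
    show "finite (A - B) \<and> finite (B - A)" if "rep A = rep B"
      using that rep_le[of A B] rep_le[of B A] by simp
  next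
    assume AB: "finite (A - B) \<and> finite (B - A)"
    \<comment> \<open>The choice in \<open>rep\<close> depends only on the predicate
      \<open>E A\<close>, so equivalent sets receive the same representative.\<close>
    have "E A C \<longleftrightarrow> E B C" for C
    proof -
      have "A - C \<subseteq> (A - B) \<union> (B - C)" "B - C \<subseteq> (B - A) \<union> (A - C)"
        "C - A \<subseteq> (C - B) \<union> (B - A)" "C - B \<subseteq> (C - A) \<union> (A - B)" by auto
      then show ?thesis unfolding E_def using AB by (meson finite_Un finite_subset)
    qed
    then show "rep A = rep B" by (simp add: rep_def)
  qed
  define Q :: "'a gorder" where "Q = \<lparr>carrier = range f, eq = (=), le = le T\<rparr>"
  \<comment> \<open>The powerset modulo finite sets, ordered by inclusion up to finitely many
    elements.\<close>
  define M :: "'a gorder" where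
    "M = \<lparr>carrier = range (f \<circ> rep), eq = (=), le = (\<lambda>u v. finite (g u - g v))\<rparr>"
  have Q_simps [simp]: "carrier Q = range f" "eq Q = (=)" "le Q = le T" by (auto simp: Q_def)
  have M_simps [simp]: "carrier M = range (\<lambda>A. f (rep A))" "eq M = (=)"
    "le M u v \<longleftrightarrow> finite (g u - g v)" for u v
    by (auto simp: M_def)
  interpret Q: partial_order Q
    by unfold_locales (auto simp: f(2) inj)
  interpret M: partial_order M
  proof unfold_locales
    fix x y z
    assume "x \<in> carrier M" "y \<in> carrier M" "z \<in> carrier M" "le M x y" "le M y z"
    moreover have "g x - g z \<subseteq> (g x - g y) \<union> (g y - g z)" by auto
    ultimately show "le M x z" by (auto intro: finite_subset)
  qed (auto simp: rep_le rep_eq inj)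
  have Qlub: "is_lub Q (f (A \<union> B)) {f A, f B}" for A B
    by (rule least_UpperI) (auto simp: f(2) Upper_def)
  have Qglb: "is_glb Q (f (A \<inter> B)) {f A, f B}" for A B
    by (rule greatest_LowerI) (auto simp: f(2) Lower_def)
  have Mlub: "is_lub M (f (rep (A \<union> B))) {f (rep A), f (rep B)}" for A B
    by (rule least_UpperI) (auto simp: rep_le Upper_def Un_Diff Diff_Un)
  have [simp]: "A \<inter> B - A = {}" "A \<inter> B - B = {}" for A B :: "nat set" by auto
  have Mglb: "is_glb M (f (rep (A \<inter> B))) {f (rep A), f (rep B)}" for A B
    by (rule greatest_LowerI) (auto simp: rep_le Lower_def Diff_Int)
  have "lattice Q"
  proof unfold_locales
    fix x y assume "x \<in> carrier Q" "y \<in> carrier Q"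
    then obtain A B where "x = f A" "y = f B" by auto
    then show "\<exists>s. is_lub Q s {x, y}" "\<exists>s. is_glb Q s {x, y}" using Qlub Qglb by blast+
  qed
  moreover have "lattice M"
  proof unfold_locales
    fix x y assume "x \<in> carrier M" "y \<in> carrier M"
    then obtain A B where "x = f (rep A)" "y = f (rep B)" by auto
    then show "\<exists>s. is_lub M s {x, y}" "\<exists>s. is_glb M s {x, y}" using Mlub Mglb by blast+
  qed
  ultimately have "join_pres Q M (\<lambda>x. f (rep (g x)))" "meet_pres Q M (\<lambda>x. f (rep (g x)))"
    by (auto simp: join_pres_def meet_pres_def Q.join_eq[OF Qlub] Q.meet_eq[OF Qglb]
        M.join_eq[OF Mlub] M.meet_eq[OF Mglb])
  then have "lattice_quotient M Q"
    unfolding lattice_quotient_def by (intro exI[of _ "\<lambda>x. f (rep (g x))"]) (auto simp: image_image)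
  moreover have "order_retract Q T"
  proof -
    \<comment> \<open>Singletons suffice for a retraction: the section is the inclusion, and at
      \<open>t = f A\<close> the condition \<open>f {n} \<sqsubseteq> t\<close> says
      \<open>n \<in> A\<close>.\<close>
    define r where "r t = f {n. f {n} \<sqsubseteq> t}" for t
    have "isotone Q T (\<lambda>x. x)"
      by (auto simp: isotone_def Q.weak_partial_order_axioms T.weak_partial_order_axioms)
    moreover have "isotone T Q r"
    proof (rule isotoneI[OF T.weak_partial_order_axioms Q.weak_partial_order_axioms])
      fix x y assume xy: "x \<in> carrier T" "y \<in> carrier T" "x \<sqsubseteq> y"
      have "f {n} \<sqsubseteq> y" if "f {n} \<sqsubseteq> x" for n
        using T.le_trans[OF that xy(3) f(1) xy(1,2)] .
      then show "le Q (r x) (r y)"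
        by (simp add: r_def f(2) Collect_mono)
    qed
    moreover have "r \<in> carrier T \<rightarrow> carrier Q"
      by (auto simp: r_def)
    moreover have "\<forall>x\<in>carrier Q. r x = x"
      by (auto simp: r_def f(2))
    ultimately show ?thesis
      unfolding order_retract_def
      using Q.partial_order_axioms T.partial_order_axioms f(1)
      by (intro conjI bexI[of _ "\<lambda>x. x"] bexI[of _ r]) auto
  qed
  ultimately have "complete_lattice M"
    using rqc unfolding retract_quotients_complete_def by blast
  then interpret M: complete_lattice M .
  \<comment> \<open>The classes of the columns of \<omega> \<times> \<omega>. Their upper bounds in
    \<open>M\<close> are the classes of sets that contain all but finitely many points of each
    column.\<close>
  let ?X = "range (\<lambda>n. f (rep {k. fst (prod_decode k) = n}))"
  have X: "?X \<subseteq> carrier M" by auto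
  have up: "f (rep B) \<in> Upper M ?X \<longleftrightarrow> (\<forall>n. finite ({k. fst (prod_decode k) = n} - B))" for B
  proof -
    have "f (rep B) \<in> Upper M ?X \<longleftrightarrow> (\<forall>x\<in>?X. le M x (f (rep B)))"
    proof -
      have "f (rep B) \<in> carrier M" by simp
      then show ?thesis unfolding Upper_def using X by blast
    qed
    then show ?thesis by (simp add: rep_le)
  qed
  obtain s where s: "is_lub M s ?X" using M.sup_exists[OF X] by auto
  then obtain S where S: "s = f (rep S)" using least_closed[OF s] by auto
  have "f (rep S) \<in> Upper M ?X" using least_mem[OF s] S by simp
  then have "finite ({k. fst (prod_decode k) = n} - S)" for n
    using up by blast
  then obtain S' where S': "\<And>n. finite ({k. fst (prod_decode k) = n} - S')" "infinite (S - S')"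
    by (rule almost_upper_bounds_not_least) blast
  have "le M s (f (rep S'))" using least_le[OF s] up S'(1) by blast
  then show False using S S'(2) by (simp add: rep_le)
qed

text \<open>The identity makes \<open>T\<close> a retract and a quotient of itself.\<close>

lemma complete_lattice_if_retract_quotients_complete:
  fixes T :: "'a gorder" (structure)
  assumes "retract_quotients_complete TYPE('a) TYPE('a) T" and "lattice T"
  shows "complete_lattice T"
proof -
  interpret lattice T by fact
  have "isotone T T (\<lambda>x. x)"
    by (simp add: isotone_def weak_partial_order_axioms)
  then have "order_retract T T"
    unfolding order_retract_def using partial_order_axioms
    by (auto intro!: bexI[of _ "\<lambda>x. x"])
  moreover have "lattice_quotient T T"
    unfolding lattice_quotient_def join_pres_def meet_pres_def using assms(2)
    by (intro exI[of _ "\<lambda>x. x"]) auto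
  ultimately show ?thesis
    using assms(1) unfolding retract_quotients_complete_def by blast
qed


section \<open>The poset of convex sublattices\<close>

lemma convex_sublattices_simps [simp]:
  "eq (convex_sublattices T) = (=)"
  "le (convex_sublattices T) = bi_dominated T"
  by (simp_all add: convex_sublattices_def)

lemma mem_convex_sublattices:
  "X \<in> carrier (convex_sublattices T) \<longleftrightarrow> X \<noteq> {} \<and> X \<subseteq> carrier T \<and>
     (\<forall>x\<in>X. \<forall>z\<in>X. \<forall>y\<in>carrier T. x \<sqsubseteq>\<^bsub>T\<^esub> y \<longrightarrow> y \<sqsubseteq>\<^bsub>T\<^esub> z \<longrightarrow> y \<in> X) \<and>
     (\<forall>x\<in>X. \<forall>y\<in>X. x \<squnion>\<^bsub>T\<^esub> y \<in> X \<and> x \<sqinter>\<^bsub>T\<^esub> y \<in> X)"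
  by (auto simp: convex_sublattices_def order_convex_def sublattice_def at_least_at_most_def
      subset_iff)

lemma convex_sublatticesD:
  assumes "X \<in> carrier (convex_sublattices T)"
  shows "X \<noteq> {}" "X \<subseteq> carrier T"
    "\<And>x y. x \<in> X \<Longrightarrow> y \<in> X \<Longrightarrow> x \<squnion>\<^bsub>T\<^esub> y \<in> X" "\<And>x y. x \<in> X \<Longrightarrow> y \<in> X \<Longrightarrow> x \<sqinter>\<^bsub>T\<^esub> y \<in> X"
    "\<And>x y z. x \<in> X \<Longrightarrow> z \<in> X \<Longrightarrow> y \<in> carrier T \<Longrightarrow> x \<sqsubseteq>\<^bsub>T\<^esub> y \<Longrightarrow> y \<sqsubseteq>\<^bsub>T\<^esub> z \<Longrightarrow> y \<in> X"
proof -
  note X = assms[unfolded mem_convex_sublattices]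
  show "X \<noteq> {}" by (rule conjunct1[OF X])
  show "X \<subseteq> carrier T" by (rule conjunct1[OF conjunct2[OF X]])
  note convex = conjunct1[OF conjunct2[OF conjunct2[OF X]]]
    and sublattice = conjunct2[OF conjunct2[OF conjunct2[OF X]]]
  show "x \<squnion>\<^bsub>T\<^esub> y \<in> X" "x \<sqinter>\<^bsub>T\<^esub> y \<in> X" if "x \<in> X" "y \<in> X" for x y
    using sublattice that by blast+
  show "y \<in> X" if "x \<in> X" "z \<in> X" "y \<in> carrier T" "x \<sqsubseteq>\<^bsub>T\<^esub> y" "y \<sqsubseteq>\<^bsub>T\<^esub> z" for x y z
    using convex that by blast
qed

lemma bi_dominated_iff:
  assumes "X \<subseteq> carrier T" "Y \<subseteq> carrier T"
  shows "bi_dominated T X Y \<longleftrightarrow>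
    (\<forall>x\<in>X. \<exists>y\<in>Y. x \<sqsubseteq>\<^bsub>T\<^esub> y) \<and> (\<forall>y\<in>Y. \<exists>x\<in>X. x \<sqsubseteq>\<^bsub>T\<^esub> y)"
  using assms by (auto simp: bi_dominated_def down_set_def up_set_def subset_iff)

text \<open>Antisymmetry is where convexity enters: if \<open>X\<close> and \<open>Y\<close>
  dominate each other, every element of \<open>X\<close> lies between two elements of
  \<open>Y\<close>.\<close>

lemma partial_order_convex_sublattices:
  fixes T :: "'a gorder" (structure)
  assumes "partial_order T"
  shows "partial_order (convex_sublattices T)"
proof -
  interpret partial_order T by fact
  note sub = convex_sublatticesD(2)
  have antisym: "X \<subseteq> Y"
    if X: "X \<in> carrier (convex_sublattices T)" and Y: "Y \<in> carrier (convex_sublattices T)"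
      and XY: "bi_dominated T X Y" and YX: "bi_dominated T Y X" for X Y
  proof
    fix x assume x: "x \<in> X"
    obtain y where y: "y \<in> Y" "x \<sqsubseteq> y"
      using XY x unfolding bi_dominated_iff[OF sub[OF X] sub[OF Y]] by blast
    obtain z where z: "z \<in> Y" "z \<sqsubseteq> x"
      using YX x unfolding bi_dominated_iff[OF sub[OF Y] sub[OF X]] by blast
    show "x \<in> Y"
      using convex_sublatticesD(5)[OF Y z(1) y(1) _ z(2) y(2)] x sub[OF X] by blast
  qed
  have trans: "bi_dominated T X Z"
    if X: "X \<subseteq> carrier T" and Y: "Y \<subseteq> carrier T" and Z: "Z \<subseteq> carrier T"
      and XY: "bi_dominated T X Y" and YZ: "bi_dominated T Y Z" for X Y Z
    unfolding bi_dominated_iff[OF X Z]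
  proof (intro conjI ballI)
    note XY = XY[unfolded bi_dominated_iff[OF X Y]] and YZ = YZ[unfolded bi_dominated_iff[OF Y Z]]
    fix x assume x: "x \<in> X"
    obtain y where y: "y \<in> Y" "x \<sqsubseteq> y" using XY x by blast
    obtain z where z: "z \<in> Z" "y \<sqsubseteq> z" using YZ y(1) by blast
    have "x \<sqsubseteq> z"
      using le_trans[OF y(2) z(2)] subsetD[OF X x] subsetD[OF Y y(1)] subsetD[OF Z z(1)] by simp
    then show "\<exists>z\<in>Z. x \<sqsubseteq> z" using z(1) by blast
  next
    note XY = XY[unfolded bi_dominated_iff[OF X Y]] and YZ = YZ[unfolded bi_dominated_iff[OF Y Z]]
    fix z assume z: "z \<in> Z"
    obtain y where y: "y \<in> Y" "y \<sqsubseteq> z" using YZ z by blast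
    obtain x where x: "x \<in> X" "x \<sqsubseteq> y" using XY y(1) by blast
    have "x \<sqsubseteq> z"
      using le_trans[OF x(2) y(2)] subsetD[OF X x(1)] subsetD[OF Y y(1)] subsetD[OF Z z] by simp
    then show "\<exists>x\<in>X. x \<sqsubseteq> z" using x(1) by blast
  qed
  have refl: "bi_dominated T X X" if "X \<subseteq> carrier T" for X
    unfolding bi_dominated_iff[OF that that] using subsetD[OF that] le_refl by blast
  have "weak_partial_order (convex_sublattices T)"
  proof (rule weak_partial_order.intro)
    show "equivalence (convex_sublattices T)"
      by (rule equivalence.intro) simp_all
    show "weak_partial_order_axioms (convex_sublattices T)"
    proof (rule weak_partial_order_axioms.intro, unfold convex_sublattices_simps)
      show "X = Y" if "bi_dominated T X Y" "bi_dominated T Y X"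
          "X \<in> carrier (convex_sublattices T)" "Y \<in> carrier (convex_sublattices T)" for X Y
        using that antisym by (intro equalityI)
      show "bi_dominated T X Z" if "bi_dominated T X Y" "bi_dominated T Y Z"
          "X \<in> carrier (convex_sublattices T)" "Y \<in> carrier (convex_sublattices T)"
          "Z \<in> carrier (convex_sublattices T)" for X Y Z
        by (rule trans[OF that(3-5)[THEN sub] that(1,2)])
    qed (auto intro!: refl sub)
  qed
  then show ?thesis
    by (intro partial_order.intro partial_order_axioms.intro) simp_all
qed

text \<open>Singletons place a copy of \<open>T\<close> among its convex sublattices, through which
  completeness is brought back to \<open>T\<close>.\<close>

lemma singleton_mem_convex_sublattices:
  fixes T :: "'a gorder"
  assumes "lattice T" "x \<in> carrier T"
  shows "{x} \<in> carrier (convex_sublattices T)"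
proof -
  interpret lattice T by fact
  have "is_lub T x {x, x}" "is_glb T x {x, x}"
    using assms(2) by (auto intro: least_UpperI greatest_LowerI)
  then have "x \<squnion>\<^bsub>T\<^esub> x = x" "x \<sqinter>\<^bsub>T\<^esub> x = x"
    using join_eq[of x x x] meet_eq[of x x x] by auto
  then show ?thesis
    using assms(2) by (auto simp: mem_convex_sublattices intro: le_antisym)
qed

section \<open>Completeness of the convex sublattices: (i) implies (iii)\<close>

lemma complete_lattice_if_convex_sublattices:
  fixes T :: "'a gorder" (structure)
  assumes "complete_lattice (convex_sublattices T)" "lattice T"
  shows "complete_lattice T"
proof -
  interpret T: lattice T by fact
  interpret C: complete_lattice "convex_sublattices T" by fact
  note sing = singleton_mem_convex_sublattices[OF assms(2)]
  show ?thesis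
  proof (rule T.complete_lattice_if_lubs)
    fix A assume A: "A \<subseteq> carrier T"
    then have sA: "(\<lambda>a. {a}) ` A \<subseteq> carrier (convex_sublattices T)" using sing by auto
    then obtain B where B: "is_lub (convex_sublattices T) B ((\<lambda>a. {a}) ` A)"
      using C.sup_exists by blast
    have B_sub: "B \<subseteq> carrier T" "B \<noteq> {}"
      using convex_sublatticesD(1,2)[OF least_closed[OF B]] by simp_all
    \<comment> \<open>Any member of \<open>B\<close> will do: it lies above each \<open>a\<close>
      because \<open>B\<close> dominates \<open>{a}\<close>, and below each upper bound
      \<open>u\<close> because \<open>{u}\<close> dominates \<open>B\<close>.\<close>
    then obtain b where b: "b \<in> B" by auto
    have up: "a \<sqsubseteq> b" if "a \<in> A" for a
      using least_Upper_above[OF B _ sA, of "{a}"] that A B_sub b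
      by (auto simp: bi_dominated_iff)
    have "is_lub T b A"
    proof (rule least_UpperI)
      fix u assume "u \<in> Upper T A"
      then have u: "u \<in> carrier T" "\<forall>a\<in>A. a \<sqsubseteq> u" using A by (auto simp: Upper_def)
      then have "{u} \<in> Upper (convex_sublattices T) ((\<lambda>a. {a}) ` A)"
        using sing A by (auto simp: Upper_def bi_dominated_iff)
      then have "bi_dominated T B {u}" using least_le[OF B] by simp
      then show "b \<sqsubseteq> u" using u b B_sub by (simp add: bi_dominated_iff)
    qed (use up A b B_sub in auto)
    then show "\<exists>s. is_lub T s A" ..
  qed
qed

text \<open>The sets \<open>K A\<close> reproduce the powerset modulo finite sets. A supremum of
  those of the columns would give an almost upper bound \<open>S\<close> of the columns that is
  almost contained in every other one.\<close>

lemma not_embeddable_if_convex_sublattices: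
  fixes T :: "'a gorder" (structure)
  assumes "complete_lattice (convex_sublattices T)" "lattice T"
  shows "\<not> order_embeddable powerset_omega T"
proof
  assume "order_embeddable powerset_omega T"
  then obtain f :: "nat set \<Rightarrow> 'a" where f: "\<And>A. f A \<in> carrier T" "\<And>A B. f A \<sqsubseteq> f B \<longleftrightarrow> A \<subseteq> B"
    by (rule order_embeddable_powersetE) blast
  interpret T: lattice T by fact
  interpret C: complete_lattice "convex_sublattices T" by fact
  \<comment> \<open>Allowing \<open>D\<close> and \<open>E\<close> to be almost above and almost below \<open>A\<close> gives the same union of
      intervals as finite modifications of \<open>A\<close>.\<close>
  define K where "K A = {t \<in> carrier T. \<exists>D E. f D \<sqsubseteq> t \<and> t \<sqsubseteq> f E \<and> finite (A - D) \<and> finite (E - A)}" for A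
  have KI: "t \<in> K A"
    if "f D \<sqsubseteq> t" "t \<sqsubseteq> f E" "finite (A - D)" "finite (E - A)" "t \<in> carrier T" for t A D E
    using that unfolding K_def by blast
  have f_K: "f D \<in> K A" if "finite (A - D)" "finite (D - A)" for A D
    using that by (intro KI[of D _ D]) (auto simp: f)
  have K_sub: "K A \<subseteq> carrier T" for A by (auto simp: K_def)
  have K: "K A \<in> carrier (convex_sublattices T)" for A
    unfolding mem_convex_sublattices
  proof (intro conjI ballI impI)
    show "K A \<noteq> {}" using f_K[of A A] by auto
    show "K A \<subseteq> carrier T" by (rule K_sub)
    fix x z assume "x \<in> K A" "z \<in> K A"
    then obtain D E D' E' where x: "x \<in> carrier T" "f D \<sqsubseteq> x" "x \<sqsubseteq> f E" "finite (A - D)" "finite (E - A)"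
      and z: "z \<in> carrier T" "f D' \<sqsubseteq> z" "z \<sqsubseteq> f E'" "finite (A - D')" "finite (E' - A)"
      unfolding K_def by blast
    note [simp] = f x(1) z(1)
    \<comment> \<open>One interval, from \<open>f (D \<inter> D')\<close> to
      \<open>f (E \<union> E')\<close>, contains both \<open>x\<close> and \<open>z\<close>, hence
      also their join and meet.\<close>
    have fin: "finite (A - D \<inter> D')" "finite (E \<union> E' - A)" using x z by (auto simp: Diff_Int Un_Diff)
    have le: "f (D \<inter> D') \<sqsubseteq> x" "f (D \<inter> D') \<sqsubseteq> z" "x \<sqsubseteq> f (E \<union> E')" "z \<sqsubseteq> f (E \<union> E')"
      using T.le_trans[OF _ x(2), of "f (D \<inter> D')"] T.le_trans[OF _ z(2), of "f (D \<inter> D')"]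
        T.le_trans[OF x(3), of "f (E \<union> E')"] T.le_trans[OF z(3), of "f (E \<union> E')"] by auto
    show "y \<in> K A" if "y \<in> carrier T" "x \<sqsubseteq> y" "y \<sqsubseteq> z" for y
      using that x z T.le_trans[OF x(2)] T.le_trans[OF _ z(3)] by (intro KI[of D y E']) auto
    show "x \<squnion> z \<in> K A"
      using fin le T.le_trans[OF le(1) T.join_left]
      by (intro KI[of "D \<inter> D'" _ "E \<union> E'"]) (auto intro!: T.join_le)
    show "x \<sqinter> z \<in> K A"
      using fin le T.le_trans[OF T.meet_left le(3)]
      by (intro KI[of "D \<inter> D'" _ "E \<union> E'"]) (auto intro!: T.meet_le)
  qed
  have K_le: "bi_dominated T (K A) (K B)" if AB: "finite (A - B)" for A B
    unfolding bi_dominated_iff[OF K_sub K_sub]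
  proof (intro conjI ballI)
    fix x assume "x \<in> K A"
    then obtain E where E: "x \<in> carrier T" "x \<sqsubseteq> f E" "finite (E - A)" unfolding K_def by blast
    \<comment> \<open>\<open>E\<close> is almost contained in \<open>A\<close>, hence in
      \<open>B\<close>, so adding \<open>B\<close> gives a finite modification of \<open>B\<close>.
      Dually, \<open>D \<inter> A\<close> below is a finite modification of
      \<open>A\<close>.\<close>
    have "E \<union> B - B \<subseteq> (E - A) \<union> (A - B)" by auto
    then have "f (E \<union> B) \<in> K B" using AB E by (intro f_K) (auto intro: finite_subset)
    moreover have "x \<sqsubseteq> f (E \<union> B)" using T.le_trans[OF E(2), of "f (E \<union> B)"] E(1) f by auto
    ultimately show "\<exists>y\<in>K B. x \<sqsubseteq> y" by blast
  next
    fix y assume "y \<in> K B"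
    then obtain D where D: "y \<in> carrier T" "f D \<sqsubseteq> y" "finite (B - D)" unfolding K_def by blast
    have "A - D \<inter> A \<subseteq> (A - B) \<union> (B - D)" by auto
    then have "f (D \<inter> A) \<in> K A" using AB D by (intro f_K) (auto intro: finite_subset)
    moreover have "f (D \<inter> A) \<sqsubseteq> y" using T.le_trans[OF _ D(2), of "f (D \<inter> A)"] D(1) f by auto
    ultimately show "\<exists>x\<in>K A. x \<sqsubseteq> y" by blast
  qed
  define B where "B n = {k. fst (prod_decode k) = n}" for n
  have KB: "range (\<lambda>n. K (B n)) \<subseteq> carrier (convex_sublattices T)" using K by auto
  obtain Z where Z: "is_lub (convex_sublattices T) Z (range (\<lambda>n. K (B n)))"
    using C.sup_exists[OF KB] by auto
  have Z_sub: "Z \<subseteq> carrier T" "Z \<noteq> {}"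
    using convex_sublatticesD(1,2)[OF least_closed[OF Z]] by simp_all
  then obtain d where d: "d \<in> Z" by auto
  then have dT: "d \<in> carrier T" using Z_sub by auto
  \<comment> \<open>The element \<open>d\<close> need not be in the image of \<open>f\<close>. The
    set \<open>S\<close> stands in for it, lying between all \<open>A\<close> with
    \<open>f A \<sqsubseteq> d\<close> and all \<open>A\<close> with
    \<open>d \<sqsubseteq> f A\<close>.\<close>
  define S where "S = {n. f {n} \<sqsubseteq> d}"
  have S_lower: "A \<subseteq> S" if "f A \<sqsubseteq> d" for A
    using that T.le_trans[OF _ that] f dT by (auto simp: S_def)
  have S_upper: "S \<subseteq> A" if "d \<sqsubseteq> f A" for A
  proof
    fix n assume "n \<in> S"
    then have "f {n} \<sqsubseteq> f A" using T.le_trans[OF _ that, of "f {n}"] f(1) dT by (simp add: S_def)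
    then show "n \<in> A" by (simp add: f(2))
  qed
  have "finite (B n - S)" for n
  proof -
    have "bi_dominated T (K (B n)) Z"
      using least_Upper_above[OF Z _ KB, of "K (B n)"] by auto
    then obtain x where x: "x \<in> K (B n)" "x \<sqsubseteq> d"
      using d bi_dominated_iff[OF K_sub Z_sub(1)] by blast
    then obtain D where D: "x \<in> carrier T" "f D \<sqsubseteq> x" "finite (B n - D)" unfolding K_def by blast
    have "D \<subseteq> S" using T.le_trans[OF D(2) x(2)] f D(1) dT by (intro S_lower) auto
    then have "B n - S \<subseteq> B n - D" by auto
    then show ?thesis using D(3) by (rule finite_subset)
  qed
  then obtain S' where S': "\<And>n. finite (B n - S')" "infinite (S - S')"
    unfolding B_def by (rule almost_upper_bounds_not_least) blast
  have "K S' \<in> Upper (convex_sublattices T) (range (\<lambda>n. K (B n)))"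
    using K K_le S'(1) by (auto simp: Upper_def)
  then have "bi_dominated T Z (K S')" using least_le[OF Z] by simp
  then obtain y where y: "y \<in> K S'" "d \<sqsubseteq> y"
    using d bi_dominated_iff[OF Z_sub(1) K_sub] by blast
  then obtain E where E: "y \<in> carrier T" "y \<sqsubseteq> f E" "finite (E - S')" unfolding K_def by blast
  \<comment> \<open>Leastness of \<open>Z\<close> thus puts \<open>S\<close> inside a set almost
    contained in \<open>S'\<close>, against the choice of \<open>S'\<close>.\<close>
  have "S \<subseteq> E" using T.le_trans[OF y(2) E(2)] f E(1) dT by (intro S_upper) auto
  then have "S - S' \<subseteq> E - S'" by auto
  then show False using E(3) S'(2) finite_subset by blast
qed

section \<open>Suprema of convex sublattices: (iii) implies (i)\<close>

text \<open>Every upper bound of the family lies in \<open>F\<close>, and a least one must also lie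
  in \<open>I\<close>; so \<open>I \<inter> F\<close> is the natural candidate. The difficulty is to
  find an element in it, and stabilization provides one.\<close>

lemma complete_lattice_convex_sublattices:
  fixes T :: "'a gorder" (structure)
  assumes "complete_lattice T" "\<not> order_embeddable powerset_omega T"
  shows "complete_lattice (convex_sublattices T)"
proof -
  interpret T: complete_lattice T by fact
  interpret C: partial_order "convex_sublattices T"
    by (intro partial_order_convex_sublattices T.partial_order_axioms)
  show ?thesis
  proof (rule C.complete_lattice_if_lubs)
    fix \<A> assume \<A>: "\<A> \<subseteq> carrier (convex_sublattices T)"
    define \<U> where "\<U> = Upper (convex_sublattices T) \<A>"
    define I where "I = {x \<in> carrier T. \<forall>Y\<in>\<U>. \<exists>y\<in>Y. x \<sqsubseteq> y}"
    define F where "F = {y \<in> carrier T. \<forall>X\<in>\<A>. \<exists>x\<in>X. x \<sqsubseteq> y}"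
    have \<U>: "\<U> \<subseteq> carrier (convex_sublattices T)" by (simp add: \<U>_def)
    note \<A>_sub = convex_sublatticesD(2)[OF subsetD[OF \<A>]]
    note \<U>_sub = convex_sublatticesD(2)[OF subsetD[OF \<U>]]
    have \<A>\<U>: "bi_dominated T X Y" if "X \<in> \<A>" "Y \<in> \<U>" for X Y
      using that \<A> by (auto simp: \<U>_def Upper_def)
    note dom = bi_dominated_iff[THEN iffD1, OF \<A>_sub \<U>_sub \<A>\<U>]
    have \<A>_I: "X \<subseteq> I" if X: "X \<in> \<A>" for X
      using dom[OF X _ X] \<A>_sub[OF X] by (auto simp: I_def)
    have \<U>_F: "Y \<subseteq> F" if Y: "Y \<in> \<U>" for Y
      using dom[OF _ Y _ Y] \<U>_sub[OF Y] by (auto simp: F_def)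
    have I_D: "\<exists>y\<in>Y. x \<sqsubseteq> y" if "x \<in> I" "Y \<in> \<U>" for x Y using that by (simp add: I_def)
    have F_D: "\<exists>x\<in>X. x \<sqsubseteq> y" if "y \<in> F" "X \<in> \<A>" for y X using that by (simp add: F_def)
    have IT: "x \<in> carrier T" if "x \<in> I" for x using that by (simp add: I_def)
    have FT: "x \<in> carrier T" if "x \<in> F" for x using that by (simp add: F_def)
    have I_down: "x \<in> I" if "x \<sqsubseteq> y" "y \<in> I" "x \<in> carrier T" for x y
      unfolding I_def
    proof (intro CollectI conjI ballI)
      fix Y assume Y: "Y \<in> \<U>"
      obtain u where u: "u \<in> Y" "y \<sqsubseteq> u" using \<open>y \<in> I\<close> Y by (auto simp: I_def)
      then have "u \<in> carrier T" using \<U>_sub[OF Y] by blast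
      then have "x \<sqsubseteq> u" using T.le_trans[OF that(1) u(2)] that IT by blast
      then show "\<exists>u\<in>Y. x \<sqsubseteq> u" using u(1) by blast
    qed (rule that)
    have F_up: "y \<in> F" if "x \<sqsubseteq> y" "x \<in> F" "y \<in> carrier T" for x y
      unfolding F_def
    proof (intro CollectI conjI ballI)
      fix X assume X: "X \<in> \<A>"
      obtain u where u: "u \<in> X" "u \<sqsubseteq> x" using \<open>x \<in> F\<close> X by (auto simp: F_def)
      then have "u \<in> carrier T" using \<A>_sub[OF X] by blast
      then have "u \<sqsubseteq> y" using T.le_trans[OF u(2) that(1)] that FT by blast
      then show "\<exists>u\<in>X. u \<sqsubseteq> y" using u(1) by blast
    qed (rule that)
    \<comment> \<open>This uses that the members of \<open>\<U>\<close> are closed under joins;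
      dually, \<open>F_meet\<close> uses closure of the members of \<open>\<A>\<close> under
      meets.\<close>
    have I_join: "x \<squnion> y \<in> I" if "x \<in> I" "y \<in> I" for x y
      unfolding I_def
    proof (intro CollectI conjI ballI)
      fix Y assume Y: "Y \<in> \<U>"
      obtain u v where uv: "u \<in> Y" "v \<in> Y" "x \<sqsubseteq> u" "y \<sqsubseteq> v" using \<open>x \<in> I\<close> \<open>y \<in> I\<close> Y unfolding I_def by blast
      have [simp]: "u \<in> carrier T" "v \<in> carrier T" using uv \<U>_sub[OF Y] by auto
      have "x \<squnion> y \<sqsubseteq> u \<squnion> v"
        using IT that uv T.le_trans[OF uv(3) T.join_left] T.le_trans[OF uv(4) T.join_right]
        by (intro T.join_le) auto
      then show "\<exists>w\<in>Y. x \<squnion> y \<sqsubseteq> w" using convex_sublatticesD(3)[OF subsetD[OF \<U> Y]] uv by blast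
    qed (use that IT in auto)
    have F_meet: "x \<sqinter> y \<in> F" if "x \<in> F" "y \<in> F" for x y
      unfolding F_def
    proof (intro CollectI conjI ballI)
      fix X assume X: "X \<in> \<A>"
      obtain u v where uv: "u \<in> X" "v \<in> X" "u \<sqsubseteq> x" "v \<sqsubseteq> y" using \<open>x \<in> F\<close> \<open>y \<in> F\<close> X unfolding F_def by blast
      have [simp]: "u \<in> carrier T" "v \<in> carrier T" using uv \<A>_sub[OF X] by auto
      have "u \<sqinter> v \<sqsubseteq> x \<sqinter> y"
        using FT that uv T.le_trans[OF T.meet_left uv(3)] T.le_trans[OF T.meet_right uv(4)]
        by (intro T.meet_le) auto
      then show "\<exists>w\<in>X. w \<sqsubseteq> x \<sqinter> y" using convex_sublatticesD(4)[OF subsetD[OF \<A> X]] uv by blast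
    qed (use that FT in auto)
    have top: "\<top> \<in> F"
      unfolding F_def
    proof (intro CollectI conjI ballI)
      fix X assume X: "X \<in> \<A>"
      obtain x where "x \<in> X" using convex_sublatticesD(1)[OF subsetD[OF \<A> X]] by auto
      then show "\<exists>x\<in>X. x \<sqsubseteq> \<top>" using T.top_higher[OF subsetD[OF \<A>_sub[OF X]]] by blast
    qed auto
    obtain y where y: "y \<in> F" "\<And>t. t \<in> F \<Longrightarrow> \<exists>i\<in>I. y \<sqsubseteq> i \<squnion> t"
    proof (rule stabilization[OF assms, of I F])
      have "\<bottom> \<in> I"
        unfolding I_def
      proof (intro CollectI conjI ballI)
        fix Y assume Y: "Y \<in> \<U>"
        obtain y where "y \<in> Y" using convex_sublatticesD(1)[OF subsetD[OF \<U> Y]] by auto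
        then show "\<exists>y\<in>Y. \<bottom> \<sqsubseteq> y" using T.bottom_lower[OF subsetD[OF \<U>_sub[OF Y]]] by blast
      qed auto
      then show "I \<noteq> {}" by auto
      show "\<Squnion>((\<lambda>i. i \<sqinter> y) ` I) \<in> F" if y: "y \<in> F" for y
        unfolding F_def
      proof (intro CollectI conjI ballI)
        have c: "(\<lambda>i. i \<sqinter> y) ` I \<subseteq> carrier T" using y by (auto simp: FT IT)
        then show s: "\<Squnion>((\<lambda>i. i \<sqinter> y) ` I) \<in> carrier T" by simp
        fix X assume X: "X \<in> \<A>"
        obtain x where x: "x \<in> X" "x \<sqsubseteq> y" using y X by (auto simp: F_def)
        \<comment> \<open>As \<open>x\<close> lies in \<open>I\<close> and below \<open>y\<close>,
          it is itself one of the elements \<open>i \<sqinter> y\<close> whose supremum is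
          taken.\<close>
        then have "x \<in> I" using \<A>_I X by auto
        then have "x \<sqinter> y \<sqsubseteq> \<Squnion>((\<lambda>i. i \<sqinter> y) ` I)"
          using c by (intro T.sup_upper) auto
        moreover have "x \<sqinter> y = x"
          using T.le_iff_join[of x y] x \<open>x \<in> I\<close> y IT FT by auto
        ultimately show "\<exists>x\<in>X. x \<sqsubseteq> \<Squnion>((\<lambda>i. i \<sqinter> y) ` I)" using x by auto
      qed
      show "I \<subseteq> carrier T" "F \<subseteq> carrier T" by (auto simp: I_def F_def)
      show "F \<noteq> {}" using top by blast
    next
      fix y assume "y \<in> F" "\<And>t. t \<in> F \<Longrightarrow> \<exists>i\<in>I. y \<sqsubseteq> i \<squnion> t"
      then show thesis by (rule that)
    qed (simp_all add: I_join F_meet)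
    have "y \<in> I"
      unfolding I_def
    proof (intro CollectI conjI ballI)
      fix Y assume Y: "Y \<in> \<U>"
      obtain t where t: "t \<in> Y" using convex_sublatticesD(1)[OF subsetD[OF \<U> Y]] by auto
      \<comment> \<open>Since \<open>i\<close> is below some \<open>u\<close> in \<open>Y\<close>,
        the element \<open>y\<close> is below \<open>u \<squnion> t\<close>, which is in
        \<open>Y\<close> because \<open>Y\<close> is a sublattice.\<close>
      obtain i where i: "i \<in> I" "y \<sqsubseteq> i \<squnion> t" using y(2) t \<U>_F[OF Y] by blast
      obtain u where u: "u \<in> Y" "i \<sqsubseteq> u" using i Y by (auto simp: I_def)
      have [simp]: "u \<in> carrier T" "t \<in> carrier T" using u t \<U>_sub[OF Y] by auto
      have "i \<squnion> t \<sqsubseteq> u \<squnion> t"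
        using IT[OF i(1)] T.le_trans[OF u(2) T.join_left] T.join_right by (intro T.join_le) auto
      then have "y \<sqsubseteq> u \<squnion> t"
        using T.le_trans[OF i(2)] IT[OF i(1)] FT[OF y(1)] by auto
      then show "\<exists>w\<in>Y. y \<sqsubseteq> w" using convex_sublatticesD(3)[OF subsetD[OF \<U> Y]] u t by blast
    qed (rule FT[OF y(1)])
    note [simp] = FT[OF y(1)]
    have Z_sub: "I \<inter> F \<subseteq> carrier T" by (auto simp: IT)
    have Z: "I \<inter> F \<in> carrier (convex_sublattices T)"
      unfolding mem_convex_sublattices
    proof (intro conjI ballI impI)
      show "I \<inter> F \<noteq> {}" using y(1) \<open>y \<in> I\<close> by auto
      fix x z assume xz: "x \<in> I \<inter> F" "z \<in> I \<inter> F"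
      then have [simp]: "x \<in> carrier T" "z \<in> carrier T" by (auto simp: IT)
      show "w \<in> I \<inter> F" if "w \<in> carrier T" "x \<sqsubseteq> w" "w \<sqsubseteq> z" for w
        using that xz I_down F_up by blast
      show "x \<squnion> z \<in> I \<inter> F"
        using xz I_join F_up[OF T.join_left, of x z] by auto
      show "x \<sqinter> z \<in> I \<inter> F"
        using xz F_meet I_down[OF T.meet_left, of x z] by auto
    qed (rule Z_sub)
    have "is_lub (convex_sublattices T) (I \<inter> F) \<A>"
    proof (rule least_UpperI)
      fix X assume X: "X \<in> \<A>"
      have "\<exists>z\<in>I \<inter> F. x \<sqsubseteq> z" if "x \<in> X" for x
      proof -
        have x: "x \<in> I" "x \<in> carrier T" using that \<A>_I[OF X] IT by auto
        \<comment> \<open>The single element \<open>y\<close> moves everything into the candidate: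
          joining with it takes \<open>I\<close> into \<open>I \<inter> F\<close>, and meeting with
          it takes \<open>F\<close> there.\<close>
        then have "x \<squnion> y \<in> I \<inter> F"
          using I_join[OF x(1) \<open>y \<in> I\<close>] F_up[OF T.join_right y(1), of x] by auto
        then show ?thesis using x(2) T.join_left[of x y] by auto
      qed
      then show "le (convex_sublattices T) X (I \<inter> F)"
        unfolding convex_sublattices_simps bi_dominated_iff[OF \<A>_sub[OF X] Z_sub]
        using F_D[OF _ X] by blast
    next
      fix Y assume "Y \<in> Upper (convex_sublattices T) \<A>"
      then have Y: "Y \<in> \<U>" by (simp add: \<U>_def)
      have "\<exists>z\<in>I \<inter> F. z \<sqsubseteq> t" if "t \<in> Y" for t
      proof -
        have t: "t \<in> F" "t \<in> carrier T" using that \<U>_F[OF Y] FT by auto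
        then have "t \<sqinter> y \<in> I \<inter> F"
          using F_meet[OF t(1) y(1)] I_down[OF T.meet_right \<open>y \<in> I\<close>, of t] by auto
        then show ?thesis using t(2) T.meet_left[of t y] by auto
      qed
      then show "le (convex_sublattices T) (I \<inter> F) Y"
        unfolding convex_sublattices_simps bi_dominated_iff[OF Z_sub \<U>_sub[OF Y]]
        using I_D[OF _ Y] by blast
    qed (use \<A> Z in auto)
    then show "\<exists>s. is_lub (convex_sublattices T) s \<A>" ..
  qed
qed

theorem theorem1:
  fixes T :: "'a gorder"
  assumes "lattice T"
  shows "(complete_lattice (convex_sublattices T) \<longleftrightarrow>
            retract_quotients_complete TYPE('a) TYPE('a) T) \<and>
         (retract_quotients_complete TYPE('a) TYPE('a) T \<longleftrightarrow>
            complete_lattice T \<and> \<not> order_embeddable powerset_omega T) \<and>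
         (retract_quotients_complete TYPE('a) TYPE('a) T \<longrightarrow>
            retract_quotients_complete TYPE('b) TYPE('c) T)"
proof -
  let ?iii = "complete_lattice T \<and> \<not> order_embeddable powerset_omega T"
  have "complete_lattice (convex_sublattices T) \<longleftrightarrow> ?iii"
    using assms complete_lattice_if_convex_sublattices not_embeddable_if_convex_sublattices
      complete_lattice_convex_sublattices by blast
  moreover have "retract_quotients_complete TYPE('a) TYPE('a) T \<longleftrightarrow> ?iii"
    using assms complete_lattice_if_retract_quotients_complete
      not_embeddable_if_retract_quotients_complete retract_quotients_completeI by blast
  \<comment> \<open>For the last conjunct, (ii) over \<open>'a\<close> gives (iii), and (iii) gives
    (ii) over all types; so testing carriers in \<open>'a\<close> is no restriction.\<close>
  ultimately show ?thesis
    using retract_quotients_completeI by blast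
qed

end
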